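(* For each integer $t\ge 1$ let $L_{\mathrm c}(t)$ be the number of $3\times 3$ magilatin squares all of whose entries are strictly between $0$ and $t$. Then $\sum_{t>0} L_{\mathrm c}(t)\,x^t$ equals $$\frac{12x^4\,B(x)}{(1-x^2)^2(1-x^3)^2(1-x^4)(1-x^5)},$$ where $$B(x)=79x^{15}+190x^{14}+260x^{13}+250x^{12}+211x^{11}+179x^{10}+181x^9+198x^8+210x^7+181x^6+125x^5+61x^4+22x^3+8x^2+4x+1.$$ Moreover, for every integer $t\ge1$, $$L_{\mathrm c}(t)=\begin{cases}\frac{3}{10}t^5-\frac{51}{8}t^4+\frac{202}{3}t^3-\frac{3769}{10}t^2+c_1(t)\,t-c_0(t), & t\text{ even},\\[3pt]\frac{3}{10}t^5-\frac{51}{8}t^4+\frac{202}{3}t^3-\frac{7493}{20}t^2+c_1(t)\,t-c_0(t), & t\text{ odd},\end{cases}$$ where $c_1(t)=994$ if $t\equiv0,2$; $986$ if $t\equiv4$; $\frac{1909}{2}$ if $t\equiv1$; $\frac{1925}{2}$ if $t\equiv3,5\pmod 6$; and $c_0(t)$ depends only on $t$ modulo $60$ and is given as follows, where in the line for $r$ the five numbers are the values of $c_0$ at $t\equiv r,\ r+12,\ r+24,\ r+36,\ r+48\pmod{60}$, in this order: $r=0$: $948,\ 948,\ \frac{4884}{5},\ \frac{4452}{5},\ \frac{4884}{5}$; $r=1$: $\frac{76933}{120},\ \frac{87301}{120},\ \frac{16769}{24},\ \frac{16769}{24},\ \frac{87301}{120}$; $r=2$: $\frac{2780}{3},\ \frac{14332}{15},\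 \frac{13036}{15},\ \frac{14332}{15},\ \frac{2780}{3}$; $r=3$: $\frac{35607}{40},\ \frac{6891}{8},\ \frac{6891}{8},\ \frac{35607}{40},\ \frac{32151}{40}$; $r=4$: $\frac{13292}{15},\ \frac{11996}{15},\ \frac{13292}{15},\ \frac{2572}{3},\ \frac{2572}{3}$; $r=5$: $\frac{18433}{24},\ \frac{18433}{24},\ \frac{95621}{120},\ \frac{85253}{120},\ \frac{95621}{120}$; $r=6$: $\frac{4452}{5},\ \frac{4884}{5},\ 948,\ 948,\ \frac{4884}{5}$; $r=7$: $\frac{18497}{24},\ \frac{95941}{120},\ \frac{85573}{120},\ \frac{95941}{120},\ \frac{18497}{24}$; $r=8$: $\frac{14332}{15},\ \frac{2780}{3},\ \frac{2780}{3},\ \frac{14332}{15},\ \frac{13036}{15}$; $r=9$: $\frac{32727}{40},\ \frac{29271}{40},\ \frac{32727}{40},\ \frac{6315}{8},\ \frac{6315}{8}$; $r=10$: $\frac{2572}{3},\ \frac{2572}{3},\ \frac{13292}{15},\ \frac{11996}{15},\ \frac{13292}{15}$; $r=11$: $\frac{93893}{120},\ \frac{104261}{120},\ \frac{20161}{24},\ \frac{20161}{24},\ \frac{104261}{120}$. The quasipolynomial $L_{\mathrm c}$ has period exactly $60$, and its principal constituent is $\frac{3}{10}t^5-\frac{51}{8}t^4+\frac{202}{3}t^3-\frac{3769}{10}t^2+994t-948$.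
   Context: A $3\times3$ magilatin square is a $3\times 3$ matrix of positive integers in which all three row sums and all three column sums are equal, and in which the three entries of each row are pairwise distinct and the three entries of each column are pairwise distinct (entries in different rows and different columns may be equal). Squares are counted as matrices (not up to symmetry). A function $N$ of $t\in\mathbb Z_{>0}$ is a quasipolynomial if there are a positive integer $p$ and polynomials $N_0,\dots,N_{p-1}$ (the constituents) with $N(t)=N_{t \bmod p}(t)$; the minimal such $p$ is the period, and $N_0$ is the principal constituent. *)

theory Defs
  imports "HOL-Analysis.Analysis"
    "HOL-Computational_Algebra.Formal_Power_Series"
begin

definition magilatin_square :: "nat ^ 3 ^ 3 \<Rightarrow> bool" where
  "magilatin_square A \<longleftrightarrow>
     (\<forall>i j. 0 < A $ i $ j) \<and>
     (\<exists>s. (\<forall>i. (\<Sum>j\<in>UNIV. A $ i $ j) = s) \<and> (\<forall>j. (\<Sum>i\<in>UNIV. A $ i $ j) = s)) \<and>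
     (\<forall>i. inj (\<lambda>j. A $ i $ j)) \<and>
     (\<forall>j. inj (\<lambda>i. A $ i $ j))"

definition L_c :: "nat \<Rightarrow> nat" where
  "L_c t = card {A. magilatin_square A \<and> (\<forall>i j. 0 < A $ i $ j \<and> A $ i $ j < t)}"

text \<open>
  Quasipolynomials are functions of a positive integer; the value of the function at \<open>0\<close>
  is never constrained. Only the values of \<open>Q\<close> below \<open>p\<close> matter.
\<close>

definition constituents_of :: "(nat \<Rightarrow> real) \<Rightarrow> nat \<Rightarrow> (nat \<Rightarrow> real poly) \<Rightarrow> bool" where
  "constituents_of N p Q \<longleftrightarrow> 0 < p \<and> (\<forall>t>0. N t = poly (Q (t mod p)) (real t))"

definition quasipolynomial :: "(nat \<Rightarrow> real) \<Rightarrow> bool" where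
  "quasipolynomial N \<longleftrightarrow> (\<exists>p Q. constituents_of N p Q)"

definition quasipolynomial_period :: "(nat \<Rightarrow> real) \<Rightarrow> nat" where
  "quasipolynomial_period N = (LEAST p. \<exists>Q. constituents_of N p Q)"

text \<open>
  The description below is unique for a quasipolynomial, since a polynomial is determined by
  its values at the positive multiples of the period.
\<close>

definition principal_constituent :: "(nat \<Rightarrow> real) \<Rightarrow> real poly" where
  "principal_constituent N =
     (THE P. \<exists>Q. constituents_of N (quasipolynomial_period N) Q \<and> Q 0 = P)"

definition c1 :: "nat \<Rightarrow> real" where
  "c1 t = (if t mod 6 = 0 \<or> t mod 6 = 2 then 994
           else if t mod 6 = 4 then 986
           else if t mod 6 = 1 then 1909 / 2
           else 1925 / 2)"

text \<open>
  Row \<open>r\<close> lists the values at \<open>t \<equiv> r, r + 12, r + 24, r + 36, r + 48\<close> modulo \<open>60\<close>.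
\<close>

definition c0_table :: "real list list" where
  "c0_table =
    [[948, 948, 4884/5, 4452/5, 4884/5],
     [76933/120, 87301/120, 16769/24, 16769/24, 87301/120],
     [2780/3, 14332/15, 13036/15, 14332/15, 2780/3],
     [35607/40, 6891/8, 6891/8, 35607/40, 32151/40],
     [13292/15, 11996/15, 13292/15, 2572/3, 2572/3],
     [18433/24, 18433/24, 95621/120, 85253/120, 95621/120],
     [4452/5, 4884/5, 948, 948, 4884/5],
     [18497/24, 95941/120, 85573/120, 95941/120, 18497/24],
     [14332/15, 2780/3, 2780/3, 14332/15, 13036/15],
     [32727/40, 29271/40, 32727/40, 6315/8, 6315/8],
     [2572/3, 2572/3, 13292/15, 11996/15, 13292/15],
     [93893/120, 104261/120, 20161/24, 20161/24, 104261/120]]"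

definition c0 :: "nat \<Rightarrow> real" where
  "c0 t = c0_table ! (t mod 12) ! ((t mod 60) div 12)"

end

theory Submission
  imports Defs
begin

text \<open>
  A semimagic square of order 3 is, after rearranging its cells, an addition table \<open>e\<^bsub>k\<^esub> + d\<^bsub>l\<^esub>\<close> of two
  triples, which are unique up to opposite shifts. Two distinct cells lie on a common line of the
  square iff they differ in both \<open>k\<close> and \<open>l\<close>; hence the square is magilatin iff the sets of pairwise
  distances of \<open>e\<close> and of \<open>d\<close> are disjoint. If the spans of the triples are \<open>p\<close> and \<open>q\<close>, with middle
  elements at \<open>a\<close> and \<open>c\<close>, this excludes for each \<open>c\<close> at most six values of \<open>a\<close>, and the coincidences
  among these six depend only on the parities of \<open>p\<close> and \<open>q\<close> and on the position of \<open>p\<close> relative to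
  \<open>2q\<close> and \<open>3q/2\<close>. Summing over \<open>p + q = n\<close> gives the second difference of \<open>L_c\<close> at \<open>n\<close> in closed form,
  where the conditions \<open>p = 2q\<close> and \<open>2p = 3q\<close> bring in divisibility of \<open>n\<close> by 3 and by 5.
\<close>

section \<open>Squares as addition tables\<close>

text \<open>Absolute difference inside the naturals: truncation makes one of the summands 0.\<close>

definition dist3 :: "nat \<Rightarrow> nat \<Rightarrow> nat" where
  "dist3 x y = (x - y) + (y - x)"

lemma dist3_eq_iff: "dist3 x y = dist3 u v \<longleftrightarrow> x + u = y + v \<or> x + v = y + u"
  unfolding dist3_def by arith

fun gaps :: "nat \<times> nat \<times> nat \<Rightarrow> nat set" where
  "gaps (x, y, z) = {dist3 x y, dist3 x z, dist3 y z}"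

text \<open>
  With indices modulo 3 the entry in row \<open>i\<close> and column \<open>j\<close> is \<open>e\<^bsub>i+j\<^esub> + d\<^bsub>i-j\<^esub>\<close>: a combination of
  the three even permutation matrices (weights \<open>e\<close>) and of the three odd ones (weights \<open>d\<close>).
\<close>

fun square_of :: "(nat \<times> nat \<times> nat) \<times> (nat \<times> nat \<times> nat) \<Rightarrow> nat ^ 3 ^ 3" where
  "square_of ((e0, e1, e2), (d0, d1, d2)) =
     vector [vector [e0 + d0, e1 + d2, e2 + d1],
             vector [e1 + d1, e2 + d0, e0 + d2],
             vector [e2 + d2, e0 + d1, e1 + d0]]"

lemma inj_3: "inj (f :: 3 \<Rightarrow> 'a) \<longleftrightarrow> f 1 \<noteq> f 2 \<and> f 1 \<noteq> f 3 \<and> f 2 \<noteq> f 3"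
  unfolding inj_def forall_3 by auto

text \<open>The 18 pairs of cells on a common line correspond to a pair of \<open>e\<close>'s, a
  pair of \<open>d\<close>'s and a sign. Equality of the two entries says that a difference of
  \<open>e\<close>'s is, with that sign, a difference of \<open>d\<close>'s; both signs together
  compare distances.\<close>

lemma magilatin_square_of:
  "magilatin_square (square_of (e, d)) \<longleftrightarrow>
     (\<forall>i j. 0 < square_of (e, d) $ i $ j) \<and> gaps e \<inter> gaps d = {}"
proof (cases e; cases d)
  fix e0 e1 e2 d0 d1 d2
  assume e: "e = (e0, e1, e2)" and d: "d = (d0, d1, d2)"
  have "\<exists>s. (\<forall>i. (\<Sum>j\<in>UNIV. square_of (e, d) $ i $ j) = s) \<and>
            (\<forall>j. (\<Sum>i\<in>UNIV. square_of (e, d) $ i $ j) = s)"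
    \<comment> \<open>Every row and every column contains each of the six weights once.\<close>
    by (rule exI[of _ "e0 + e1 + e2 + d0 + d1 + d2"]) (simp add: e d forall_3 sum_3 vector_3)
  moreover have "(\<forall>i. inj (\<lambda>j. square_of (e, d) $ i $ j)) \<and> (\<forall>j. inj (\<lambda>i. square_of (e, d) $ i $ j))
      \<longleftrightarrow> gaps e \<inter> gaps d = {}"
    by (simp add: e d inj_3 forall_3 vector_3 dist3_eq_iff) (smt (verit) add.commute)
  ultimately show ?thesis unfolding magilatin_square_def by blast
qed

fun min3 :: "nat \<times> nat \<times> nat \<Rightarrow> nat" where "min3 (x, y, z) = min x (min y z)"
fun max3 :: "nat \<times> nat \<times> nat \<Rightarrow> nat" where "max3 (x, y, z) = max x (max y z)"

text \<open>All nine sums occur as entries, so the extreme entries are the sums of the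
  extremes.\<close>

lemma entries_square_of:
  assumes "min3 d = 0"
  shows "(\<forall>i j. 0 < square_of (e, d) $ i $ j \<and> square_of (e, d) $ i $ j < t) \<longleftrightarrow>
           0 < min3 e \<and> max3 e + max3 d < t"
proof (cases e; cases d)
  fix e0 e1 e2 d0 d1 d2
  assume e: "e = (e0, e1, e2)" and d: "d = (d0, d1, d2)"
  show ?thesis
    using assms unfolding e d min3.simps max3.simps max_add_distrib_left max_add_distrib_right
    by (cases "d0 = 0"; cases "d1 = 0"; auto simp: forall_3 vector_3 min_def split: if_splits)
qed

text \<open>Opposite shifts of \<open>e\<close> and \<open>d\<close> are the only freedom, and
  minimum 0 pins them down.\<close>

lemma square_of_inj: 
  assumes "square_of (e, d) = square_of (e', d')" "min3 d = 0" "min3 d' = 0"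
  shows "e = e' \<and> d = d'"
proof (cases e; cases d; cases e'; cases d')
  fix e0 e1 e2 d0 d1 d2 e0' e1' e2' d0' d1' d2'
  assume e: "e = (e0, e1, e2)" and d: "d = (d0, d1, d2)"
    and e': "e' = (e0', e1', e2')" and d': "d' = (d0', d1', d2')"
  show ?thesis
    using assms by (simp add: e d e' d' vec_eq_iff forall_3 vector_3 min_def split: if_splits)
qed

lemma square_of_surj:
  assumes "magilatin_square A"
  obtains e d where "A = square_of (e, d)" "min3 d = 0"
proof -
  define a where "a i j = A $ i $ j" for i j
  from assms obtain s where
    "\<forall>i. (\<Sum>j\<in>UNIV. a i j) = s" "\<forall>j. (\<Sum>i\<in>UNIV. a i j) = s"
    unfolding magilatin_square_def a_def by blast
  hence sums: "a 1 1 + a 1 2 + a 1 3 = s" "a 2 1 + a 2 2 + a 2 3 = s" "a 3 1 + a 3 2 + a 3 3 = s"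
     "a 1 1 + a 2 1 + a 3 1 = s" "a 1 2 + a 2 2 + a 3 2 = s" "a 1 3 + a 2 3 + a 3 3 = s"
    by (auto simp: forall_3 sum_3)
  have A: "A = square_of ((e0, e1, e2), (d0, d1, d2))"
    if "a 1 1 = e0 + d0" "a 1 2 = e1 + d2" "a 1 3 = e2 + d1"
       "a 2 1 = e1 + d1" "a 2 2 = e2 + d0" "a 2 3 = e0 + d2"
       "a 3 1 = e2 + d2" "a 3 2 = e0 + d1" "a 3 3 = e1 + d0" for e0 e1 e2 d0 d1 d2
    using that by (simp add: a_def vec_eq_iff forall_3 vector_3)
  \<comment> \<open>These three cells hold \<open>e0\<close> plus \<open>d0\<close>,
    \<open>d1\<close>, \<open>d2\<close>. Their minimum becomes \<open>e0\<close>, which makes one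
    of the \<open>d\<close>'s 0, and the cells with that \<open>d\<close> show \<open>e1\<close> and
    \<open>e2\<close>. The witnesses stand in the order \<open>e0\<close>, \<open>d0\<close>,
    \<open>e1\<close>, \<open>d2\<close>, \<open>e2\<close>, \<open>d1\<close>.\<close>
  consider "a 1 1 \<le> a 3 2" "a 1 1 \<le> a 2 3" | "a 3 2 \<le> a 1 1" "a 3 2 \<le> a 2 3"
    | "a 2 3 \<le> a 1 1" "a 2 3 \<le> a 3 2" by linarith
  then show ?thesis
  proof cases
    case 1
    show ?thesis
      by (rule that[OF A[of "a 1 1" 0 "a 3 3" "a 2 3 - a 1 1" "a 2 2" "a 3 2 - a 1 1"]])
         (use 1 sums in auto)
  next
    case 2
    show ?thesis
      by (rule that[OF A[of "a 3 2" "a 1 1 - a 3 2" "a 2 1" "a 2 3 - a 3 2" "a 1 3" 0]])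
         (use 2 sums in auto)
  next
    case 3
    show ?thesis
      by (rule that[OF A[of "a 2 3" "a 1 1 - a 2 3" "a 1 2" 0 "a 3 1" "a 3 2 - a 2 3"]])
         (use 3 sums in auto)
  qed
qed

lemma L_c_eq_card_pairs:
  "L_c t = card {(e, d). 0 < min3 e \<and> min3 d = 0 \<and> max3 e + max3 d < t \<and> gaps e \<inter> gaps d = {}}"
    (is "_ = card ?S")
proof -
  have "bij_betw square_of ?S {A. magilatin_square A \<and> (\<forall>i j. 0 < A $ i $ j \<and> A $ i $ j < t)}"
    (is "bij_betw _ _ ?T")
  proof (rule bij_betw_imageI)
    show "inj_on square_of ?S"
      by (rule inj_onI) (auto dest: square_of_inj)
    show "square_of ` ?S = ?T"
    proof
      show "square_of ` ?S \<subseteq> ?T"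
      proof clarify
        fix e d assume *: "0 < min3 e" "min3 d = 0" "max3 e + max3 d < t" "gaps e \<inter> gaps d = {}"
        then show "magilatin_square (square_of (e, d)) \<and>
          (\<forall>i j. 0 < square_of (e, d) $ i $ j \<and> square_of (e, d) $ i $ j < t)"
          using entries_square_of[OF *(2), of e t] unfolding magilatin_square_of by blast
      qed
      show "?T \<subseteq> square_of ` ?S"
      proof clarify
        fix A assume A: "magilatin_square A" "\<forall>i j. 0 < A $ i $ j \<and> A $ i $ j < t"
        from A(1) obtain e d where ed: "A = square_of (e, d)" "min3 d = 0"
          by (rule square_of_surj)
        with A have "(e, d) \<in> ?S"
          using entries_square_of[OF ed(2), of e t] magilatin_square_of[of e d] by simp
        with ed(1) show "A \<in> square_of ` ?S" by blast
      qed
    qed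
  qed
  then show ?thesis unfolding L_c_def by (simp add: bij_betw_same_card)
qed

section \<open>Triples sorted by minimum, span and middle element\<close>

definition arrangements :: "nat \<Rightarrow> nat \<Rightarrow> nat \<Rightarrow> (nat \<times> nat \<times> nat) set" where
  "arrangements m p a =
     {(m, m + a, m + p), (m, m + p, m + a), (m + a, m, m + p),
      (m + a, m + p, m), (m + p, m, m + a), (m + p, m + a, m)}"

text \<open>For \<open>a \<le> p\<close>, the number of distinct orderings: repeated values among 0,
  \<open>a\<close>, \<open>p\<close> merge some of the six.\<close>

definition wt :: "nat \<Rightarrow> nat \<Rightarrow> nat" where
  "wt p a = (if p = 0 then 1 else if a = 0 \<or> a = p then 3 else 6)"

lemma finite_arrangements: "finite (arrangements m p a)"
  by (simp add: arrangements_def)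

lemma card_arrangements: "a \<le> p \<Longrightarrow> card (arrangements m p a) = wt p a"
  by (auto simp: arrangements_def wt_def card_insert_if)

lemma arrangements_props:
  assumes "x \<in> arrangements m p a" "a \<le> p"
  shows "min3 x = m" "max3 x = m + p" "gaps x = {a, p - a, p}"
  using assms by (auto simp: arrangements_def dist3_def)

lemma arrangements_inj:
  assumes "x \<in> arrangements m p a" "x \<in> arrangements m' p' a'" "a \<le> p" "a' \<le> p'"
  shows "m = m' \<and> p = p' \<and> a = a'"
  using assms by (auto simp: arrangements_def)

lemma arrangements_exhaust:
  obtains m p a where "x \<in> arrangements m p a" "a \<le> p"
proof (cases x)
  case (fields u v w)
  consider "u \<le> v" "v \<le> w" | "u \<le> w" "w \<le> v" | "v \<le> u" "u \<le> w" | "v \<le> w" "w \<le> u"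
    | "w \<le> u" "u \<le> v" | "w \<le> v" "v \<le> u" by linarith
  then show ?thesis
  proof cases
    case 1 then show ?thesis by (intro that[of u "w - u" "v - u"]) (auto simp: fields arrangements_def)
  next
    case 2 then show ?thesis by (intro that[of u "v - u" "w - u"]) (auto simp: fields arrangements_def)
  next
    case 3 then show ?thesis by (intro that[of v "w - v" "u - v"]) (auto simp: fields arrangements_def)
  next
    case 4 then show ?thesis by (intro that[of v "u - v" "w - v"]) (auto simp: fields arrangements_def)
  next
    case 5 then show ?thesis by (intro that[of w "v - w" "u - w"]) (auto simp: fields arrangements_def)
  next
    case 6 then show ?thesis by (intro that[of w "u - w" "v - w"]) (auto simp: fields arrangements_def)
  qed
qed

definition compatible :: "nat \<Rightarrow> nat \<Rightarrow> (nat \<times> nat) set" where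
  "compatible p q = {(a, c). a \<le> p \<and> c \<le> q \<and> {a, p - a, p} \<inter> {c, q - c, q} = {}}"

definition pair_weight :: "nat \<Rightarrow> nat \<Rightarrow> nat" where
  "pair_weight p q = (\<Sum>(a, c)\<in>compatible p q. wt p a * wt q c)"

lemma finite_compatible: "finite (compatible p q)"
  by (rule finite_subset[of _ "{..p} \<times> {..q}"]) (auto simp: compatible_def)

definition spans :: "nat \<Rightarrow> (nat \<times> nat \<times> nat) set" where
  "spans t = {(m, p, q). 0 < m \<and> m + p + q < t}"

lemma finite_spans: "finite (spans t)"
  by (rule finite_subset[of _ "{..t} \<times> {..t} \<times> {..t}"]) (auto simp: spans_def)

text \<open>The pairs of triples split into disjoint blocks, one for each choice of minimum, spans
  and middle elements. A block is a product of two sets of orderings, and the bound sees only the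
  largest entry \<open>m + p + q\<close>.\<close>

lemma L_c_eq_sum: "L_c t = (\<Sum>(m, p, q)\<in>spans t. pair_weight p q)"
proof -
  let ?I = "SIGMA x:spans t. case x of (m, p, q) \<Rightarrow> compatible p q"
  let ?B = "\<lambda>((m, p, q), (a, c)). arrangements m p a \<times> arrangements 0 q c"
  have "{(e, d). 0 < min3 e \<and> min3 d = 0 \<and> max3 e + max3 d < t \<and> gaps e \<inter> gaps d = {}} = \<Union> (?B ` ?I)"
    (is "?S = _")
  proof
    show "?S \<subseteq> \<Union> (?B ` ?I)"
    proof clarify
      fix e d :: "nat \<times> nat \<times> nat"
      assume *: "0 < min3 e" "min3 d = 0" "max3 e + max3 d < t" "gaps e \<inter> gaps d = {}"
      obtain m p a where e: "e \<in> arrangements m p a" "a \<le> p" by (rule arrangements_exhaust)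
      obtain m' q c where d: "d \<in> arrangements m' q c" "c \<le> q" by (rule arrangements_exhaust)
      note props = arrangements_props[OF e] arrangements_props[OF d]
      have "((m, p, q), (a, c)) \<in> ?I"
        using * e(2) d(2) unfolding props by (auto simp: spans_def compatible_def)
      moreover have "(e, d) \<in> ?B ((m, p, q), (a, c))"
        using e d * by (auto simp: props)
      ultimately show "(e, d) \<in> \<Union> (?B ` ?I)" by blast
    qed
    show "\<Union> (?B ` ?I) \<subseteq> ?S"
    proof clarify
      fix m p q a c e d
      assume *: "(m, p, q) \<in> spans t" "(a, c) \<in> compatible p q"
        "e \<in> arrangements m p a" "d \<in> arrangements 0 q c"
      from *(2) have le: "a \<le> p" "c \<le> q" by (auto simp: compatible_def)
      show "0 < min3 e \<and> min3 d = 0 \<and> max3 e + max3 d < t \<and> gaps e \<inter> gaps d = {}"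
        using *(1,2) unfolding arrangements_props[OF *(3) le(1)] arrangements_props[OF *(4) le(2)]
        by (auto simp: spans_def compatible_def)
    qed
  qed
  hence "L_c t = card (\<Union> (?B ` ?I))" by (simp add: L_c_eq_card_pairs)
  also have "\<dots> = (\<Sum>i\<in>?I. card (?B i))"
  proof (rule card_UN_disjoint)
    show "finite ?I" by (intro finite_SigmaI finite_spans) (auto intro: finite_compatible)
    show "\<forall>i\<in>?I. finite (?B i)" by (auto simp: finite_arrangements)
    show "\<forall>i\<in>?I. \<forall>j\<in>?I. i \<noteq> j \<longrightarrow> ?B i \<inter> ?B j = {}"
    proof (intro ballI impI)
      fix i j assume ij: "i \<in> ?I" "j \<in> ?I" "i \<noteq> j"
      obtain m p q a c where i: "i = ((m, p, q), (a, c))" by (metis surj_pair)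
      obtain m' p' q' a' c' where j: "j = ((m', p', q'), (a', c'))" by (metis surj_pair)
      have le: "a \<le> p" "c \<le> q" "a' \<le> p'" "c' \<le> q'"
        using ij(1,2) by (auto simp: i j compatible_def)
      show "?B i \<inter> ?B j = {}"
        using ij(3) le by (auto simp: i j dest: arrangements_inj)
    qed
  qed
  also have "\<dots> = (\<Sum>((m, p, q), (a, c))\<in>?I. wt p a * wt q c)"
    by (rule sum.cong) (auto simp: card_cartesian_product card_arrangements compatible_def)
  also have "\<dots> = (\<Sum>x\<in>spans t. \<Sum>(a, c)\<in>(case x of (m, p, q) \<Rightarrow> compatible p q).
                     case x of (m, p, q) \<Rightarrow> wt p a * wt q c)"
    by (subst sum.Sigma) (auto simp: finite_spans finite_compatible intro!: sum.cong)
  also have "\<dots> = (\<Sum>(m, p, q)\<in>spans t. pair_weight p q)"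
    by (rule sum.cong) (auto simp: pair_weight_def)
  finally show ?thesis .
qed

text \<open>The new spans are those with \<open>m + p + q = t\<close>. Given
  \<open>n = p + q\<close>, the minimum must be \<open>t - n\<close>, which is positive exactly for
  \<open>n < t\<close>.\<close>

lemma L_c_Suc: "L_c (Suc t) = L_c t + (\<Sum>n<t. \<Sum>q\<le>n. pair_weight (n - q) q)"
proof -
  let ?f = "\<lambda>(n, q). (t - n, n - q, q)"
  have "spans (Suc t) = spans t \<union> ?f ` (SIGMA n:{..<t}. {..n})"
  proof
    show "spans (Suc t) \<subseteq> spans t \<union> ?f ` (SIGMA n:{..<t}. {..n})"
    proof clarify
      fix m p q assume *: "(m, p, q) \<in> spans (Suc t)" "(m, p, q) \<notin> ?f ` (SIGMA n:{..<t}. {..n})"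
      show "(m, p, q) \<in> spans t"
      proof (rule ccontr)
        assume "(m, p, q) \<notin> spans t"
        with *(1) have "m + p + q = t" "0 < m" by (auto simp: spans_def)
        hence "(m, p, q) = ?f (p + q, q)" "(p + q, q) \<in> (SIGMA n:{..<t}. {..n})" by auto
        with *(2) show False by blast
      qed
    qed
  qed (auto simp: spans_def)
  moreover have "spans t \<inter> ?f ` (SIGMA n:{..<t}. {..n}) = {}" by (auto simp: spans_def)
  moreover have "(\<Sum>x\<in>?f ` (SIGMA n:{..<t}. {..n}). case x of (m, p, q) \<Rightarrow> pair_weight p q) =
      (\<Sum>n<t. \<Sum>q\<le>n. pair_weight (n - q) q)"
    by (subst sum.reindex) (auto simp: inj_on_def sum.Sigma intro!: sum.cong)
  ultimately show ?thesis unfolding L_c_eq_sum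
    by (simp add: sum.union_disjoint finite_spans)
qed

lemma L_c_0: "L_c 0 = 0"
  by (simp add: L_c_def)

section \<open>Pairs of triples with given spans\<close>

lemma pair_weight_commute: "pair_weight p q = pair_weight q p"
  unfolding pair_weight_def
  by (rule sum.reindex_bij_witness[of _ prod.swap prod.swap]) (auto simp: compatible_def)

lemma pair_weight_diag: "pair_weight p p = 0"
  unfolding pair_weight_def by (rule sum.neutral) (auto simp: compatible_def)

text \<open>For positive \<open>p\<close> the two end positions count 3 each and the
  \<open>p - 1\<close> inner ones 6 each.\<close>

lemma sum_wt: "(\<Sum>a\<le>p. wt p a) = (if p = 0 then 1 else 6 * p)"
proof (cases "p = 0")
  case False
  have eq: "{..p} = insert 0 (insert p {1..<p})" using False by auto
  have "(\<Sum>a\<in>{1..<p}. wt p a) = (\<Sum>a\<in>{1..<p}. 6)"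
    by (rule sum.cong) (auto simp: wt_def)
  thus ?thesis unfolding eq using False by (simp add: wt_def)
qed (simp add: wt_def)

text \<open>
  For second gaps \<open>{c, q - c, q}\<close> these are the \<open>a\<close> for which \<open>a\<close> or \<open>p - a\<close> is one of them.
\<close>

definition blocked :: "nat \<Rightarrow> nat \<Rightarrow> nat \<Rightarrow> nat set" where
  "blocked p q c = {c, q - c, q, p - c, p - (q - c), p - q}"

text \<open>Complementary counting: \<open>p\<close> exceeds all gaps of the second triple, so only
  \<open>a\<close> and \<open>p - a\<close> can clash, and all \<open>a\<close> together weigh
  \<open>6 * p\<close>.\<close>

lemma pair_weight_eq:
  assumes "q < p"
  shows "int (pair_weight p q) = (\<Sum>c\<le>q. int (wt q c) * (6 * int p - (\<Sum>a\<in>blocked p q c. int (wt p a))))"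
proof -
  have compat: "(a, c) \<in> compatible p q \<longleftrightarrow> c \<le> q \<and> a \<le> p \<and> a \<notin> blocked p q c" for a c
  proof (cases "c \<le> q \<and> a \<le> p")
    case True
    hence "p - a = c \<longleftrightarrow> a = p - c" "p - a = q - c \<longleftrightarrow> a = p - (q - c)" "p - a = q \<longleftrightarrow> a = p - q"
      "p \<noteq> c" "p \<noteq> q - c" "p \<noteq> q"
      using assms by linarith+
    with True show ?thesis by (simp add: compatible_def blocked_def) metis
  qed (auto simp: compatible_def)
  have "pair_weight p q = (\<Sum>(c, a)\<in>(SIGMA c:{..q}. {..p} - blocked p q c). wt p a * wt q c)"
    unfolding pair_weight_def
    by (rule sum.reindex_bij_witness[of _ prod.swap prod.swap])
       (auto simp: compat)
  also have "\<dots> = (\<Sum>c\<le>q. \<Sum>a\<in>{..p} - blocked p q c. wt p a * wt q c)"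
    by (subst sum.Sigma) auto
  also have "int \<dots> = (\<Sum>c\<le>q. int (wt q c) * (\<Sum>a\<in>{..p} - blocked p q c. int (wt p a)))"
    by (simp add: sum_distrib_left mult.commute)
  also have "\<dots> = (\<Sum>c\<le>q. int (wt q c) * (6 * int p - (\<Sum>a\<in>blocked p q c. int (wt p a))))"
  proof (rule sum.cong[OF refl])
    fix c assume "c \<in> {..q}"
    hence sub: "blocked p q c \<subseteq> {..p}" using assms by (auto simp: blocked_def)
    have "(\<Sum>a\<le>p. int (wt p a)) = 6 * int p"
      using arg_cong[OF sum_wt[of p], of int] assms by simp
    thus "int (wt q c) * (\<Sum>a\<in>{..p} - blocked p q c. int (wt p a)) =
          int (wt q c) * (6 * int p - (\<Sum>a\<in>blocked p q c. int (wt p a)))"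
      using sub by (simp add: sum_diff)
  qed
  finally show ?thesis .
qed

lemma pair_weight_0_right: "0 < p \<Longrightarrow> int (pair_weight p 0) = 6 * (int p - 1)"
  by (simp add: pair_weight_eq blocked_def wt_def)

text \<open>An equality \<open>c = x\<close> also identifies \<open>c + y\<close> with
  \<open>x + y\<close> and so costs 2, whereas \<open>c = x + y\<close> costs 1. If all three
  numbers agree, two elements remain, hence the correction.\<close>

lemma card_pair_sums:
  fixes c x y :: nat
  assumes "0 < c" "0 < x" "0 < y"
  shows "int (card {c, x, y, c + x, c + y, x + y}) =
     6 - 2 * of_bool (c = x) - 2 * of_bool (c = y) - 2 * of_bool (x = y) + 2 * of_bool (c = x \<and> x = y)
     - of_bool (c = x + y) - of_bool (x = c + y) - of_bool (y = c + x)"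
proof -
  consider "c = x" "x = y" | "c = x" "x \<noteq> y" | "c = y" "c \<noteq> x" | "x = y" "c \<noteq> x"
    | "c \<noteq> x" "x \<noteq> y" "c \<noteq> y" by blast
  thus ?thesis
  proof cases
    case 5
    \<comment> \<open>Positivity rules out two of these equations at once.\<close>
    consider "c = x + y" | "x = c + y" | "y = c + x"
      | "c \<noteq> x + y" "x \<noteq> c + y" "y \<noteq> c + x" by blast
    thus ?thesis using 5 assms by cases (auto simp: card_insert_if)
  qed (use assms in \<open>simp_all add: card_insert_if\<close>)
qed

text \<open>With \<open>q = c + x\<close> and \<open>p = c + x + y\<close> the blocked positions are
  three positive numbers and their pairwise sums.\<close>

lemma card_blocked:
  assumes "0 < c" "c < q" "q < p"
  shows "int (card (blocked p q c)) = 6 - 2 * of_bool (q = 2 * c) - of_bool (p = 2 * c)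
     - of_bool (p = 2 * (q - c)) - 2 * of_bool (p = c + q) - 2 * of_bool (p + c = 2 * q)
     - of_bool (p = 2 * q) + 2 * of_bool (2 * p = 3 * q \<and> q = 2 * c)"
proof -
  obtain x where x: "q = c + x" "0 < x" using assms by (metis less_imp_add_positive)
  obtain y where y: "p = c + x + y" "0 < y" using assms x by (metis less_imp_add_positive)
  have b: "blocked p q c = {c, x, y, c + x, c + y, x + y}"
    using x y by (auto simp: blocked_def)
  have "q = 2 * c \<longleftrightarrow> c = x" "p = 2 * c \<longleftrightarrow> c = x + y" "p = 2 * (q - c) \<longleftrightarrow> x = c + y"
    "p = c + q \<longleftrightarrow> c = y" "p + c = 2 * q \<longleftrightarrow> x = y" "p = 2 * q \<longleftrightarrow> y = c + x"
    "2 * p = 3 * q \<and> q = 2 * c \<longleftrightarrow> c = x \<and> x = y"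
    using x y by auto
  thus ?thesis unfolding b by (simp only: card_pair_sums[OF assms(1) x(2) y(2)])
qed

text \<open>Meant for equations with at most one solution \<open>k\<close>; \<open>B\<close> says
  that \<open>k\<close> is a solution within range.\<close>

lemma sum_of_bool_eq:
  assumes "finite A" "\<And>c. c \<in> A \<Longrightarrow> P c \<Longrightarrow> c = k" "k \<in> A \<Longrightarrow> P k \<longleftrightarrow> B" "B \<Longrightarrow> k \<in> A"
  shows "(\<Sum>c\<in>A. of_bool (P c)) = (of_bool B :: int)"
proof -
  have "{c \<in> A. P c} = (if B then {k} else {})" using assms(2-4) by auto
  thus ?thesis using assms(1) by (simp add: of_bool_def sum.If_cases Int_def flip: sum.inter_filter)
qed

text \<open>The ends \<open>c = 0\<close> and \<open>c = q\<close> are separate, since they block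
  the light positions 0 and \<open>p\<close>. For inner \<open>c\<close> every weight involved is 6,
  whence the factor 36, and only the size of the blocked set matters.\<close>

lemma pair_weight_interior:
  assumes "0 < q" "q < p"
  shows "int (pair_weight p q) = 36 * ((int p - 6) * (int q - 1) + int p - 3 + int q * of_bool (p = 2 * q)
     + 2 * of_bool (even q) + of_bool (p < 2 * q) * (4 + 2 * of_bool (even p)) - 2 * of_bool (2 * p = 3 * q))"
proof -
  have eq: "{..q} = insert 0 (insert q {0<..<q})" using assms by auto
  let ?f = "\<lambda>c. int (wt q c) * (6 * int p - (\<Sum>a\<in>blocked p q c. int (wt p a)))"
  have bd: "blocked p q 0 = {0, p, q, p - q}" "blocked p q q = {0, p, q, p - q}"
    using assms by (auto simp: blocked_def)
  have f0: "?f 0 = 18 * (int p - 3 + of_bool (p = 2 * q))"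
  proof -
    have "p = 2 * q \<Longrightarrow> p - q = q" by simp
    moreover have "p \<noteq> 2 * q \<Longrightarrow> p - q \<noteq> q" by simp
    ultimately show ?thesis using assms unfolding bd
      by (cases "p = 2 * q") (auto simp: wt_def)
  qed
  have fq: "?f q = ?f 0" using assms unfolding bd by (simp add: wt_def)
  have fc: "?f c = 36 * (int p - int (card (blocked p q c)))" if "c \<in> {0<..<q}" for c
  proof -
    have "wt q c = 6" using that by (simp add: wt_def)
    moreover have "(\<Sum>a\<in>blocked p q c. int (wt p a)) = (\<Sum>a\<in>blocked p q c. 6)"
      by (rule sum.cong) (use that assms in \<open>auto simp: blocked_def wt_def\<close>)
    ultimately show ?thesis by simp
  qed
  \<comment> \<open>The conditions in \<open>s1\<close> to \<open>s6\<close> have the single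
    solutions \<open>q/2\<close>, \<open>p/2\<close>, \<open>q - p/2\<close>, \<open>p - q\<close>,
    \<open>2q - p\<close>, \<open>q/2\<close>; the right-hand sides say when these are integers
    strictly between 0 and \<open>q\<close>.\<close>
  have s1: "(\<Sum>c\<in>{0<..<q}. of_bool (q = 2 * c)) = (of_bool (even q) :: int)"
  proof (cases "even q")
    case True
    then obtain h where "q = 2 * h" by blast
    thus ?thesis using assms by (intro sum_of_bool_eq[where k = "h"]) auto
  next
    case False
    hence "\<And>c. q \<noteq> 2 * c" by auto
    thus ?thesis using False by simp
  qed
  have s2: "(\<Sum>c\<in>{0<..<q}. of_bool (p = 2 * c)) = (of_bool (even p \<and> p < 2 * q) :: int)"
  proof (cases "even p")
    case True
    then obtain h where "p = 2 * h" by blast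
    thus ?thesis using assms by (intro sum_of_bool_eq[where k = "h"]) auto
  next
    case False
    hence "\<And>c. p \<noteq> 2 * c" by auto
    thus ?thesis using False by simp
  qed
  have s3: "(\<Sum>c\<in>{0<..<q}. of_bool (p = 2 * (q - c))) = (of_bool (even p \<and> p < 2 * q) :: int)"
  proof (cases "even p")
    case True
    then obtain h where "p = 2 * h" by blast
    thus ?thesis using assms by (intro sum_of_bool_eq[where k = "q - h"]) auto
  next
    case False
    hence "\<And>c. p \<noteq> 2 * c" by auto
    thus ?thesis using False by simp
  qed
  have s4: "(\<Sum>c\<in>{0<..<q}. of_bool (p = c + q)) = (of_bool (p < 2 * q) :: int)"
    by (rule sum_of_bool_eq[where k = "p - q"]) (use assms in auto)
  have s5: "(\<Sum>c\<in>{0<..<q}. of_bool (p + c = 2 * q)) = (of_bool (p < 2 * q) :: int)"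
    by (rule sum_of_bool_eq[where k = "2 * q - p"]) (use assms in auto)
  have s6: "(\<Sum>c\<in>{0<..<q}. of_bool (2 * p = 3 * q \<and> q = 2 * c)) = (of_bool (2 * p = 3 * q) :: int)"
  proof (rule sum_of_bool_eq[where k = "q div 2"])
    have "even q" if "2 * p = 3 * q" using that by presburger
    thus "(2 * p = 3 * q \<and> q = 2 * (q div 2)) = (2 * p = 3 * q)" by auto
    show "q div 2 \<in> {0<..<q}" if "2 * p = 3 * q" using that assms by auto
  qed auto
  have "(\<Sum>c\<in>{0<..<q}. int (card (blocked p q c))) =
      (\<Sum>c\<in>{0<..<q}. 6 - 2 * of_bool (q = 2 * c) - of_bool (p = 2 * c)
       - of_bool (p = 2 * (q - c)) - 2 * of_bool (p = c + q) - 2 * of_bool (p + c = 2 * q)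
       - of_bool (p = 2 * q) + 2 * of_bool (2 * p = 3 * q \<and> q = 2 * c))"
    by (rule sum.cong[OF refl]) (simp only: greaterThanLessThan_iff card_blocked[OF _ _ assms(2)])
  also have "\<dots> = 6 * (int q - 1) - 2 * of_bool (even q) - of_bool (p < 2 * q) * (4 + 2 * of_bool (even p))
       - (int q - 1) * of_bool (p = 2 * q) + 2 * of_bool (2 * p = 3 * q)"
    unfolding sum.distrib sum_subtractf sum_distrib_left[symmetric] s1 s2 s3 s4 s5 s6
    using assms by (simp add: of_nat_diff of_bool_def algebra_simps)
  finally have card: "(\<Sum>c\<in>{0<..<q}. int (card (blocked p q c))) = \<dots>" .
  have "int (pair_weight p q) = ?f 0 + ?f q + (\<Sum>c\<in>{0<..<q}. ?f c)"
    unfolding pair_weight_eq[OF assms(2)] eq using assms(1) by simp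
  also have "(\<Sum>c\<in>{0<..<q}. ?f c) = (\<Sum>c\<in>{0<..<q}. 36 * (int p - int (card (blocked p q c))))"
    by (rule sum.cong[OF refl fc])
  also have "\<dots> = 36 * (int p * (int q - 1) - (\<Sum>c\<in>{0<..<q}. int (card (blocked p q c))))"
    unfolding sum_distrib_left[symmetric] sum_subtractf using assms(1) by (simp add: of_nat_diff)
  finally show ?thesis unfolding fq f0 card by algebra
qed

section \<open>Summation over spans with a fixed total\<close>

definition spread_weight :: "nat \<Rightarrow> nat" where
  "spread_weight n = (\<Sum>q\<le>n. pair_weight (n - q) q)"

text \<open>Exchanging the triples pairs \<open>q\<close> with \<open>n - q\<close>; equal spans are
  a common gap and contribute 0.\<close>

lemma spread_weight_half: "spread_weight n = 2 * (\<Sum>q | 2 * q < n. pair_weight (n - q) q)"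
proof -
  have fin: "finite {q. 2 * q < n}" by (rule finite_subset[of _ "{..n}"]) auto
  have "{..n} = {q. 2 * q < n} \<union> ({q. 2 * q = n} \<union> {q. n < 2 * q \<and> q \<le> n})" by auto
  hence "spread_weight n = (\<Sum>q | 2 * q < n. pair_weight (n - q) q) +
     ((\<Sum>q | 2 * q = n. pair_weight (n - q) q) + (\<Sum>q | n < 2 * q \<and> q \<le> n. pair_weight (n - q) q))"
    unfolding spread_weight_def
    by (simp only:) (subst sum.union_disjoint; use fin in \<open>auto intro!: sum.union_disjoint 
         intro: finite_subset[of _ "{..n}"]\<close>)
  also have "(\<Sum>q | 2 * q = n. pair_weight (n - q) q) = 0"
    by (rule sum.neutral) (auto simp: pair_weight_diag)
  also have "(\<Sum>q | n < 2 * q \<and> q \<le> n. pair_weight (n - q) q) = (\<Sum>q | 2 * q < n. pair_weight (n - q) q)"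
    by (rule sum.reindex_bij_witness[of _ "\<lambda>q. n - q" "\<lambda>q. n - q"]) (auto simp: pair_weight_commute)
  finally show ?thesis by simp
qed

section \<open>The second difference of the counting function\<close>

lemma sum_even_offset:
  "(\<Sum>q\<in>{1..x}. of_bool (even (n + q))) = (of_nat (if even n then x div 2 else (x + 1) div 2) :: real)"
  by (induction x) (auto elim!: evenE oddE)

lemma sum_Icc_diff:
  fixes f :: "nat \<Rightarrow> real"
  assumes "h \<le> m"
  shows "(\<Sum>q\<in>{1..m}. of_bool (h < q) * f q) = (\<Sum>q\<in>{1..m}. f q) - (\<Sum>q\<in>{1..h}. f q)"
proof -
  have "{1..m} = {1..h} \<union> {h<..m}" using assms by auto
  hence "(\<Sum>q\<in>{1..m}. g q) = (\<Sum>q\<in>{1..h}. g q) + (\<Sum>q\<in>{h<..m}. g q)" for g :: "nat \<Rightarrow> real"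
    by (simp only:) (rule sum.union_disjoint, auto)
  thus ?thesis by simp
qed

text \<open>With \<open>p = n - q\<close>, \<open>m\<close> is the largest \<open>q\<close> below
  \<open>p\<close>. The condition \<open>p < 2 * q\<close> means \<open>n < 3 * q\<close>, so
  \<open>h\<close> is its threshold; \<open>p = 2 * q\<close> means \<open>n = 3 * q\<close>, and
  \<open>2 * p = 3 * q\<close> means \<open>2 * n = 5 * q\<close>. The first summand is the doubled
  term at \<open>q = 0\<close>.\<close>

lemma spread_weight_closed_form:
  assumes "0 < n" "m = (n - 1) div 2" "h = n div 3"
  shows "real (spread_weight n) = 12 * (real n - 1) + 72 *
    ((real n - 6) * (real m * (real m + 1) / 2) - real m * (real m + 1) * (2 * real m + 1) / 6
     + 3 * real m + real h * of_bool (3 dvd n) + 2 * real (m div 2)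
     + 4 * (real m - real h)
     + 2 * (if even n then real (m div 2) - real (h div 2) else real ((m + 1) div 2) - real ((h + 1) div 2))
     - 2 * of_bool (5 dvd n))"
proof -
  have hm: "h \<le> m" using assms by linarith
  have set_eq: "{q. 2 * q < n} = insert 0 {1..m}" using assms by auto
  have Vq: "real (pair_weight (n - q) q) = 36 * ((real n - 6) * real q - (real q)\<^sup>2 + 3 + real h * of_bool (q = h \<and> 3 dvd n)
     + 2 * of_bool (even q) + of_bool (h < q) * (4 + 2 * of_bool (even (n + q)))
     - 2 * of_bool (5 dvd n \<and> q = 2 * (n div 5)))"
    if "q \<in> {1..m}" for q
  proof -
    have q: "0 < q" "q < n - q" using that assms by auto
    have eqs: "n - q = 2 * q \<longleftrightarrow> q = h \<and> 3 dvd n" "n - q < 2 * q \<longleftrightarrow> h < q"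
      "even (n - q) \<longleftrightarrow> even (n + q)" "2 * (n - q) = 3 * q \<longleftrightarrow> 5 dvd n \<and> q = 2 * (n div 5)"
    proof -
      have "n - q = 2 * q \<longleftrightarrow> n = 3 * q" using q by linarith
      thus "n - q = 2 * q \<longleftrightarrow> q = h \<and> 3 dvd n" using assms(3) by auto
      show "n - q < 2 * q \<longleftrightarrow> h < q" using q assms(3) by linarith
      show "even (n - q) \<longleftrightarrow> even (n + q)" using q by auto
      have "5 dvd n \<and> q = 2 * (n div 5)" if "2 * n = 5 * q"
      proof -
        have "5 dvd n" using that by presburger
        with that show ?thesis by auto
      qed
      moreover have "2 * (n - q) = 3 * q \<longleftrightarrow> 2 * n = 5 * q" using q by linarith
      ultimately show "2 * (n - q) = 3 * q \<longleftrightarrow> 5 dvd n \<and> q = 2 * (n div 5)" by auto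
    qed
    have "real (pair_weight (n - q) q) = of_int (int (pair_weight (n - q) q))" by simp
    also have "\<dots> = 36 * ((real n - real q - 6) * (real q - 1) + (real n - real q) - 3
       + real q * of_bool (q = h \<and> 3 dvd n) + 2 * of_bool (even q)
       + of_bool (h < q) * (4 + 2 * of_bool (even (n + q))) - 2 * of_bool (5 dvd n \<and> q = 2 * (n div 5)))"
      unfolding pair_weight_interior[OF q] eqs using q by (simp add: of_nat_diff)
    also have "real q * of_bool (q = h \<and> 3 dvd n) = real h * of_bool (q = h \<and> 3 dvd n)" by simp
    finally show ?thesis by (simp add: algebra_simps power2_eq_square)
  qed
  have V0: "real (pair_weight n 0) = 6 * (real n - 1)"
    using arg_cong[OF pair_weight_0_right[OF assms(1)], of real_of_int] by simp
  have s_q: "(\<Sum>q\<in>{1..m}. real q) = real m * (real m + 1) / 2"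
    by (induction m) (simp_all add: field_simps)
  have s_q2: "(\<Sum>q\<in>{1..m}. (real q)\<^sup>2) = real m * (real m + 1) * (2 * real m + 1) / 6"
    by (induction m) (simp_all add: field_simps power2_eq_square)
  have s_h: "(\<Sum>q\<in>{1..m}. real h * of_bool (q = h \<and> 3 dvd n)) = real h * of_bool (3 dvd n)"
  proof (cases "3 dvd n")
    case True
    hence "h \<in> {1..m}" using assms hm by auto
    thus ?thesis using True by (simp add: sum_distrib_left[symmetric] of_bool_def)
  qed simp
  have s_5: "(\<Sum>q\<in>{1..m}. of_bool (5 dvd n \<and> q = 2 * (n div 5))) = (of_bool (5 dvd n) :: real)"
  proof (cases "5 dvd n")
    case True
    hence "2 * (n div 5) \<in> {1..m}" using assms by auto
    thus ?thesis using True by (simp add: of_bool_def)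
  qed simp
  have s_e: "(\<Sum>q\<in>{1..m}. of_bool (even q)) = real (m div 2)"
    using sum_even_offset[where n = 0] by simp
  have s_he: "(\<Sum>q\<in>{1..m}. of_bool (h < q) * (4 + 2 * of_bool (even (n + q)))) =
     4 * (real m - real h)
     + 2 * (if even n then real (m div 2) - real (h div 2) else real ((m + 1) div 2) - real ((h + 1) div 2))"
    unfolding sum_Icc_diff[OF hm] sum.distrib sum_distrib_left[symmetric] sum_even_offset
    by (simp add: algebra_simps)
  have linear: "(\<Sum>q\<in>{1..m}. 36 * (a * A q - B q + 3 + C q + 2 * D q + E q - 2 * G q)) =
     36 * (a * sum A {1..m} - sum B {1..m} + 3 * real m + sum C {1..m} + 2 * sum D {1..m}
           + sum E {1..m} - 2 * sum G {1..m})" for a and A B C D E G :: "nat \<Rightarrow> real"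
    by (simp add: sum.distrib sum_subtractf flip: sum_distrib_left)
  have "real (spread_weight n) = 2 * (6 * (real n - 1) + (\<Sum>q\<in>{1..m}. real (pair_weight (n - q) q)))"
    unfolding spread_weight_half set_eq using V0 by simp
  also have "(\<Sum>q\<in>{1..m}. real (pair_weight (n - q) q)) = (\<Sum>q\<in>{1..m}. 36 * ((real n - 6) * real q
     - (real q)\<^sup>2 + 3 + real h * of_bool (q = h \<and> 3 dvd n)
     + 2 * of_bool (even q) + of_bool (h < q) * (4 + 2 * of_bool (even (n + q)))
     - 2 * of_bool (5 dvd n \<and> q = 2 * (n div 5))))"
    by (rule sum.cong[OF refl Vq])
  also have "\<dots> = 36 * ((real n - 6) * (\<Sum>q\<in>{1..m}. real q)
     - (\<Sum>q\<in>{1..m}. (real q)\<^sup>2) + 3 * real m + (\<Sum>q\<in>{1..m}. real h * of_bool (q = h \<and> 3 dvd n))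
     + 2 * (\<Sum>q\<in>{1..m}. of_bool (even q))
     + (\<Sum>q\<in>{1..m}. of_bool (h < q) * (4 + 2 * of_bool (even (n + q))))
     - 2 * (\<Sum>q\<in>{1..m}. of_bool (5 dvd n \<and> q = 2 * (n div 5))))"
    by (rule linear)
  finally show ?thesis unfolding s_q s_q2 s_h s_e s_he s_5 by simp
qed

section \<open>Comparison of second differences with the closed formula\<close>

lemma L_c_Suc_Suc: "real (L_c (t + 2)) - 2 * real (L_c (t + 1)) + real (L_c t) = real (spread_weight t)"
  using L_c_Suc[of t] L_c_Suc[of "Suc t"] by (simp add: spread_weight_def)

text \<open>At 0 this is -948 while the count is 0, so the comparison has to start at 1.\<close>

definition L_formula :: "nat \<Rightarrow> real" where
  "L_formula t = 3/10 * real t ^ 5 - 51/8 * real t ^ 4 + 202/3 * real t ^ 3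
     - (if even t then 3769/10 else 7493/20) * real t ^ 2 + c1 t * real t - c0 t"

lemma mod_add_60:
  assumes "d dvd 60"
  shows "(60 * k + s) mod d = s mod (d :: nat)"
proof -
  obtain j where "60 = d * j" using assms by blast
  hence "60 * k + s = s + d * (j * k)" by simp
  thus ?thesis by (simp only: mod_mult_self2)
qed

lemma c0_add_60: "c0 (60 * k + s) = c0 s"
  unfolding c0_def by (simp add: mod_add_60)

lemma c1_add_60: "c1 (60 * k + s) = c1 s"
  unfolding c1_def by (simp add: mod_add_60)

text \<open>The polynomials are second differences of powers. In the quadratic part,
  \<open>(T + 2)^2 + T^2\<close> is \<open>2 (T + 1)^2 + 2\<close>, and 9/2 is twice the gap between
  3769/10 and 7493/20.\<close>

lemma L_formula_second_difference:
  assumes "T = real (60 * k + s)"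
  shows "L_formula (60 * k + s + 2) - 2 * L_formula (60 * k + s + 1) + L_formula (60 * k + s) =
     3/10 * (20 * T ^ 3 + 60 * T\<^sup>2 + 70 * T + 30) - 51/8 * (12 * T\<^sup>2 + 24 * T + 14) + 202/3 * (6 * T + 6)
     - (if even s then 9/2 * (T + 1)\<^sup>2 + 3769/5 else 7493/10 - 9/2 * (T + 1)\<^sup>2)
     + c1 (s + 2) * (T + 2) - 2 * c1 (s + 1) * (T + 1) + c1 s * T
     - (c0 (s + 2) - 2 * c0 (s + 1) + c0 s)"
proof -
  have ev: "even (60 * k + s + 2) = even s" "even (60 * k + s + 1) = odd s" "even (60 * k + s) = even s"
    by simp_all
  have T: "real (60 * k + s + 2) = T + 2" "real (60 * k + s + 1) = T + 1" "real (60 * k + s) = T"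
    using assms by simp_all
  have c: "c0 (60 * k + s + 2) = c0 (s + 2)" "c0 (60 * k + s + 1) = c0 (s + 1)" "c0 (60 * k + s) = c0 s"
    "c1 (60 * k + s + 2) = c1 (s + 2)" "c1 (60 * k + s + 1) = c1 (s + 1)" "c1 (60 * k + s) = c1 s"
    using c0_add_60[of k "s + 2"] c0_add_60[of k "s + 1"] c1_add_60[of k "s + 2"] c1_add_60[of k "s + 1"]
    by (simp_all only: c0_add_60 c1_add_60 add.assoc)
  show ?thesis unfolding L_formula_def ev T c
    by (cases "even s") (simp_all add: field_simps eval_nat_numeral)
qed

text \<open>\<mu> and \<eta> are the rounding errors of \<open>m\<close> against \<open>T/2\<close>
  and of \<open>h\<close> against \<open>T/3\<close>. All roundings, including the further halvings,
  depend only on \<open>s\<close>, because 60 is divisible by 4 and 6.\<close>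

lemma spread_weight_residue:
  assumes "0 < s" "T = real (60 * k + s)" "\<mu> = real ((s - 1) div 2) - real s / 2"
    "\<eta> = real (s div 3) - real s / 3"
  shows "real (spread_weight (60 * k + s)) = 12 * (T - 1) + 72 *
    ((T - 6) * ((T / 2 + \<mu>) * (T / 2 + \<mu> + 1) / 2)
       - (T / 2 + \<mu>) * (T / 2 + \<mu> + 1) * (T + 2 * \<mu> + 1) / 6
     + 3 * (T / 2 + \<mu>) + T / 3 * of_bool (3 dvd s)
     + 2 * (T / 4 - real s / 4 + real ((s - 1) div 2 div 2))
     + 4 * (T / 6 + \<mu> - \<eta>)
     + 2 * (T / 12 - real s / 12 + (if even s then real ((s - 1) div 2 div 2) - real (s div 3 div 2)
           else real (((s - 1) div 2 + 1) div 2) - real ((s div 3 + 1) div 2)))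
     - 2 * of_bool (5 dvd s))"
proof -
  define M where "M = (s - 1) div 2"
  define H where "H = s div 3"
  have M: "(60 * k + s - 1) div 2 = 30 * k + M"
    using assms(1) unfolding M_def by linarith
  have H: "(60 * k + s) div 3 = 20 * k + H"
    unfolding H_def by linarith
  have d: "(30 * k + x) div 2 = 15 * k + x div 2" "(20 * k + x) div 2 = 10 * k + x div 2"
    "Suc (30 * k + x) div 2 = 15 * k + Suc x div 2" "Suc (20 * k + x) div 2 = 10 * k + Suc x div 2" for x
    by linarith+
  have dvd: "3 dvd 60 * k + s \<longleftrightarrow> 3 dvd s" "5 dvd 60 * k + s \<longleftrightarrow> 5 dvd s" "even (60 * k + s) \<longleftrightarrow> even s"
    by (simp_all add: dvd_eq_mod_eq_0 mod_add_60)
  have T: "T / 2 + \<mu> = real (30 * k + M)" "T / 3 * of_bool (3 dvd s) = real (20 * k + H) * of_bool (3 dvd s)"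
     "T / 4 - real s / 4 = 15 * real k" "T / 12 - real s / 12 = 5 * real k"
     "T / 6 + \<mu> - \<eta> = real (30 * k + M) - real (20 * k + H)"
     "T + 2 * \<mu> + 1 = 2 * real (30 * k + M) + 1" "T = real (60 * k + s)"
    unfolding assms M_def H_def by (auto simp: field_simps)
  show ?thesis using assms(1)
    unfolding T(1-6) unfolding T(7) M_def[symmetric] H_def[symmetric]
    by (subst spread_weight_closed_form[OF _ M[symmetric] H[symmetric]]) (simp_all add: dvd d)
qed


text \<open>
  On each residue class modulo 60 the defect of the second difference of the closed formula is a
  polynomial in \<open>t\<close>; its cubic and quadratic parts cancel identically, which leaves the two
  coefficients below to be checked on the 60 classes.
\<close>

definition residue_linear_coeff :: "nat \<Rightarrow> real" where
  "residue_linear_coeff s = c1 (s + 2) - 2 * c1 (s + 1) + c1 s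
     + (if even s then - 55 else 71) - 24 * of_bool (3 dvd s)"

definition residue_const_coeff :: "nat \<Rightarrow> real" where
  "residue_const_coeff s = (if even s then 1629 / 20 else - 4221 / 20)
     + 2 * c1 (s + 2) - 2 * c1 (s + 1) - (c0 (s + 2) - 2 * c0 (s + 1) + c0 s)
     - 72 * (2 * (real ((s - 1) div 2 div 2) - real s / 4)
     - 4 * (real (s div 3) - real s / 3)
     + 2 * (- (real s / 12) + (if even s then real ((s - 1) div 2 div 2) - real (s div 3 div 2)
           else real (((s - 1) div 2 + 1) div 2) - real ((s div 3 + 1) div 2)))
     - 2 * of_bool (5 dvd s))"

text \<open>For even arguments \<mu> is -1. The letters stand for quantities fixed by the residue:
  \<open>c12\<close>, \<open>c11\<close>, \<open>c10\<close> for values of \<open>c1\<close>,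
  \<open>e\<close> for the second difference of \<open>c0\<close>, \<open>b\<close> and
  \<open>d\<close> for divisibility by 3 and 5, \<open>h\<close> for \<eta>, \<open>x\<close> and
  \<open>y\<close> for rounded halves.\<close>

lemma even_defect_identity:
  fixes T :: real
  shows "3/10 * (20 * T ^ 3 + 60 * T\<^sup>2 + 70 * T + 30) - 51/8 * (12 * T\<^sup>2 + 24 * T + 14) + 202/3 * (6 * T + 6)
     - (9/2 * (T + 1)\<^sup>2 + 3769/5)
     + c12 * (T + 2) - 2 * c11 * (T + 1) + c10 * T - e - 
     (12 * (T - 1) + 72 *
    ((T - 6) * ((T / 2 + - 1) * (T / 2 + - 1 + 1) / 2)
       - (T / 2 + - 1) * (T / 2 + - 1 + 1) * (T + 2 * - 1 + 1) / 6
     + 3 * (T / 2 + - 1) + T / 3 * b 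
     + 2 * (T / 4 - s / 4 + x)
     + 4 * (T / 6 + - 1 - h)
     + 2 * (T / 12 - s / 12 + y)
     - 2 * d)) = 
     (c12 - 2 * c11 + c10 + - 55 - 24 * b) * T +
     (1629 / 20 + 2 * c12 - 2 * c11 - e - 72 * (2 * (x - s / 4) - 4 * h + 2 * (- (s / 12) + y) - 2 * d))"
  by (simp add: power2_eq_square power3_eq_cube field_simps)

text \<open>For odd arguments \<mu> is -1/2.\<close>

lemma odd_defect_identity:
  fixes T :: real
  shows "3/10 * (20 * T ^ 3 + 60 * T\<^sup>2 + 70 * T + 30) - 51/8 * (12 * T\<^sup>2 + 24 * T + 14) + 202/3 * (6 * T + 6)
     - (7493/10 - 9/2 * (T + 1)\<^sup>2)
     + c12 * (T + 2) - 2 * c11 * (T + 1) + c10 * T - e - 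
     (12 * (T - 1) + 72 *
    ((T - 6) * ((T / 2 + - 1 / 2) * (T / 2 + - 1 / 2 + 1) / 2)
       - (T / 2 + - 1 / 2) * (T / 2 + - 1 / 2 + 1) * (T + 2 * (- 1 / 2) + 1) / 6
     + 3 * (T / 2 + - 1 / 2) + T / 3 * b 
     + 2 * (T / 4 - s / 4 + x)
     + 4 * (T / 6 + - 1 / 2 - h)
     + 2 * (T / 12 - s / 12 + y)
     - 2 * d)) = 
     (c12 - 2 * c11 + c10 + 71 - 24 * b) * T +
     (- 4221 / 20 + 2 * c12 - 2 * c11 - e - 72 * (2 * (x - s / 4) - 4 * h + 2 * (- (s / 12) + y) - 2 * d))"
  by (simp add: power2_eq_square power3_eq_cube field_simps)

lemma residue_defect:
  assumes "0 < s" "T = real (60 * k + s)"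
  shows "L_formula (60 * k + s + 2) - 2 * L_formula (60 * k + s + 1) + L_formula (60 * k + s) - real (spread_weight (60 * k + s)) =
    residue_linear_coeff s * T + residue_const_coeff s"
proof (cases "even s")
  case True
  then obtain b where "s = 2 * b" by blast
  moreover from this have "(s - 1) div 2 = b - 1" "0 < b" using assms(1) by auto
  ultimately have \<mu>: "- 1 = real ((s - 1) div 2) - real s / 2" by (simp add: of_nat_diff)
  show ?thesis
    unfolding L_formula_second_difference[OF assms(2)] spread_weight_residue[OF assms \<mu> refl]
      residue_linear_coeff_def residue_const_coeff_def
    using True by (simp only: if_True even_defect_identity)
next
  case False
  hence \<mu>: "- 1 / 2 = real ((s - 1) div 2) - real s / 2" by (auto elim!: oddE simp: field_simps)
  show ?thesis
    unfolding L_formula_second_difference[OF assms(2)] spread_weight_residue[OF assms \<mu> refl]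
      residue_linear_coeff_def residue_const_coeff_def
    using False by (simp only: if_False odd_defect_identity)
qed

text \<open>Representatives run from 1 to 60 so that \<open>s - 1\<close> is never
  truncated.\<close>

lemma residue_coeffs_0: "\<forall>s\<in>set [1..<61]. residue_linear_coeff s = 0 \<and> residue_const_coeff s = 0"
  by code_simp

lemma L_formula_Suc_Suc:
  assumes "0 < t"
  shows "L_formula (t + 2) - 2 * L_formula (t + 1) + L_formula t = real (spread_weight t)"
proof -
  define k s where "k = (t - 1) div 60" and "s = 1 + (t - 1) mod 60"
  have t: "t = 60 * k + s" using assms unfolding k_def s_def by simp
  have s: "s \<in> set [1..<61]" unfolding s_def by auto
  have "0 < s" unfolding s_def by simp
  from residue_defect[OF this refl, of k] residue_coeffs_0 s show ?thesis
    unfolding t by auto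
qed

text \<open>Both sides vanish at 1 and 2 and have the same second difference at every positive
  argument.\<close>

lemma L_c_eq_F: "0 < t \<Longrightarrow> real (L_c t) = L_formula t"
proof (induction t rule: less_induct)
  case (less t)
  have L1: "L_c 1 = 0" using L_c_Suc[of 0] by (simp add: L_c_0)
  have L2: "L_c 2 = 0" using L_c_Suc[of 1] L1 by (simp add: pair_weight_diag numeral_2_eq_2)
  consider "t = 1" | "t = 2" | u where "t = u + 2" "0 < u"
    using less.prems by (metis One_nat_def Suc_1 add.commute add_2_eq_Suc less_imp_Suc_add neq0_conv old.nat.exhaust)
  thus ?case
  proof cases
    case 3
    have "real (L_c (u + 2)) = 2 * real (L_c (u + 1)) - real (L_c u) + real (spread_weight u)"
      using L_c_Suc_Suc[of u] by linarith
    also have "\<dots> = 2 * L_formula (u + 1) - L_formula u + real (spread_weight u)"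
      using less.IH[of "u + 1"] less.IH[of u] 3 by simp
    also have "\<dots> = L_formula (u + 2)" using L_formula_Suc_Suc[OF 3(2)] by linarith
    finally show ?thesis using 3 by simp
  qed (use L1 L2 in \<open>simp_all add: L_formula_def c1_def c0_def c0_table_def\<close>)
qed

section \<open>Generating function\<close>

text \<open>
  The denominator has \<open>1\<close> as a root of order 6, \<open>-1\<close> of order 3, the primitive cube roots of unity
  of order 2, and \<open>\<plusminus>\<i>\<close> and the primitive fifth roots of order 1, so it annihilates separately the
  terms \<open>t\<^sup>5, t\<^sup>4, t\<^sup>3\<close>, the parity-dependent \<open>t\<^sup>2\<close> term, the \<open>c1\<close> term and the \<open>c0\<close> term. This
  amounts to the vanishing of the moments defined here.
\<close>

definition den_coeffs :: "real list" where
  "den_coeffs = [1, 0, -2, -2, 0, 3, 3, 2, -1, -4, -4, -1, 2, 3, 3, 0, -2, -2, 0, 1]"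

definition moment :: "(nat \<Rightarrow> real) \<Rightarrow> nat \<Rightarrow> real" where
  "moment a m = (\<Sum>j\<leftarrow>[0..<20]. den_coeffs ! j * a j * real j ^ m)"

lemma moment_eq_sum: "moment a m = (\<Sum>j\<in>{0..<20}. den_coeffs ! j * a j * real j ^ m)"
  unfolding moment_def by (rule interv_sum_list_conv_sum_set_nat[THEN trans]) simp

text \<open>Reduces the claim to one period, taken from 20 upwards so that \<open>s - j\<close> is
  never truncated.\<close>

lemma moment_periodic:
  assumes periodic: "\<And>k s. a (p * k + s) = a s" and "0 < p"
    and zero: "\<forall>s\<in>set [20..<20 + p]. moment (\<lambda>j. a (s - j)) m = 0" and "20 \<le> n"
  shows "moment (\<lambda>j. a (n - j)) m = 0"
proof -
  define k s where "k = (n - 20) div p" and "s = 20 + (n - 20) mod p"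
  have n: "n = p * k + s" using \<open>20 \<le> n\<close> unfolding k_def s_def by simp
  have "s \<in> set [20..<20 + p]" using \<open>0 < p\<close> unfolding s_def by auto
  hence "moment (\<lambda>j. a (s - j)) m = 0" using zero by blast
  moreover have "a (n - j) = a (s - j)" if "j < 20" for j
  proof -
    have "n - j = p * k + (s - j)" using that n s_def by simp
    thus ?thesis using periodic by simp
  qed
  ultimately show ?thesis unfolding moment_eq_sum by simp
qed

lemma moment_1:
  assumes "m < 6"
  shows "moment (\<lambda>_. 1) m = 0"
proof -
  have "\<forall>m\<in>set [0..<6]. moment (\<lambda>_. 1) m = 0" by code_simp
  moreover have "m \<in> set [0..<6]" using assms by simp
  ultimately show ?thesis by (rule bspec)
qed

lemma moment_parity:
  assumes "20 \<le> n" "m < 3"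
  shows "moment (\<lambda>j. of_bool (even (n - j))) m = 0"
proof -
  have m: "m \<in> set [0..<3]" using assms(2) by simp
  have "\<forall>m\<in>set [0..<3]. \<forall>s\<in>set [20..<20 + 2]. moment (\<lambda>j. of_bool (even (s - j))) m = 0"
    by code_simp
  hence zero: "\<forall>s\<in>set [20..<20 + 2]. moment (\<lambda>j. of_bool (even (s - j))) m = 0"
    using m by (rule bspec)
  show ?thesis by (rule moment_periodic[where a = "\<lambda>t. of_bool (even t)", OF _ _ zero assms(1)]) simp_all
qed

text \<open>\<open>c1\<close> is a function of the parity plus -8 when \<open>t\<close> is 1 modulo
  3. Hence no primitive sixth roots of unity enter, and the roots that do are at least
  double.\<close>

lemma moment_c1:
  assumes "20 \<le> n" "m < 2"
  shows "moment (\<lambda>j. c1 (n - j)) m = 0"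
proof -
  have m: "m \<in> set [0..<2]" using assms(2) by simp
  have "\<forall>m\<in>set [0..<2]. \<forall>s\<in>set [20..<20 + 6]. moment (\<lambda>j. c1 (s - j)) m = 0"
    by code_simp
  hence zero: "\<forall>s\<in>set [20..<20 + 6]. moment (\<lambda>j. c1 (s - j)) m = 0"
    using m by (rule bspec)
  show ?thesis by (rule moment_periodic[where a = c1, OF _ _ zero assms(1)]) (simp_all add: c1_def)
qed

lemma c0_mod_60: "c0 (t mod 60) = c0 t"
  using c0_add_60[of "t div 60" "t mod 60"] by simp

text \<open>The first list holds the values at multiples of 15; the other two are normalised to 0 at
  residue 0. Thus only roots of unity of orders dividing 3, 4 and 5 enter \<open>c0\<close>.\<close>

lemma c0_split:
  "c0 t = [948, 6315/8, 948, 6891/8] ! (t mod 4) + [0, - 272/3, - 64/3] ! (t mod 3)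
     + [0, - 288/5, 0, 144/5, 144/5] ! (t mod 5)"
proof -
  have "\<forall>t\<in>set [0..<60]. c0 t = [948, 6315/8, 948, 6891/8] ! (t mod 4) + [0, - 272/3, - 64/3] ! (t mod 3)
     + [0, - 288/5, 0, 144/5, 144/5] ! (t mod 5)"
    by code_simp
  moreover have "t mod 60 \<in> set [0..<60]" by auto
  ultimately have "c0 (t mod 60) = [948, 6315/8, 948, 6891/8] ! (t mod 60 mod 4)
     + [0, - 272/3, - 64/3] ! (t mod 60 mod 3) + [0, - 288/5, 0, 144/5, 144/5] ! (t mod 60 mod 5)"
    by blast
  thus ?thesis by (simp add: c0_mod_60 mod_mod_cancel)
qed

lemma moment_c0:
  assumes "20 \<le> n"
  shows "moment (\<lambda>j. c0 (n - j)) 0 = 0"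
proof -
  have zero4: "\<forall>s\<in>set [20..<20 + 4]. moment (\<lambda>j. [948, 6315/8, 948, 6891/8] ! ((s - j) mod 4)) 0 = 0"
    by code_simp
  have zero3: "\<forall>s\<in>set [20..<20 + 3]. moment (\<lambda>j. [0, - 272/3, - 64/3] ! ((s - j) mod 3)) 0 = 0"
    by code_simp
  have zero5: "\<forall>s\<in>set [20..<20 + 5]. moment (\<lambda>j. [0, - 288/5, 0, 144/5, 144/5] ! ((s - j) mod 5)) 0 = 0"
    by code_simp
  have add: "moment (\<lambda>j. a j + b j + c j) 0 = moment a 0 + moment b 0 + moment c 0" for a b c
    unfolding moment_eq_sum by (simp add: sum.distrib distrib_left distrib_right)
  have "moment (\<lambda>j. [948, 6315/8, 948, 6891/8] ! ((n - j) mod 4)) 0 = 0"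
    by (rule moment_periodic[where a = "\<lambda>t. [948, 6315/8, 948, 6891/8] ! (t mod 4)", OF _ _ zero4 assms]) simp_all
  moreover have "moment (\<lambda>j. [0, - 272/3, - 64/3] ! ((n - j) mod 3)) 0 = 0"
    by (rule moment_periodic[where a = "\<lambda>t. [0, - 272/3, - 64/3] ! (t mod 3)", OF _ _ zero3 assms]) simp_all
  moreover have "moment (\<lambda>j. [0, - 288/5, 0, 144/5, 144/5] ! ((n - j) mod 5)) 0 = 0"
    by (rule moment_periodic[where a = "\<lambda>t. [0, - 288/5, 0, 144/5, 144/5] ! (t mod 5)", OF _ _ zero5 assms]) simp_all
  ultimately show ?thesis unfolding c0_split add by (simp only: add_0)
qed

text \<open>Binomial expansion sorted so that, for \<open>x = j\<close> and \<open>d\<close> the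
  matching denominator coefficient, each last factor is a summand of a moment; the factor 1 is the
  constant sequence. For even arguments \<open>9/4 * e\<close> raises 7493/20 to 3769/10.\<close>

lemma L_formula_shift_expand:
  fixes T x d e c z :: real
  shows "d * (3/10 * (T - x) ^ 5 - 51/8 * (T - x) ^ 4 + 202/3 * (T - x) ^ 3
     - (7493/20 + 9/4 * e) * (T - x) ^ 2 + c * (T - x) - z) =
     (3/10 * T ^ 5 - 51/8 * T ^ 4 + 202/3 * T ^ 3 - 7493/20 * T ^ 2) * (d * 1 * x ^ 0)
     + (- 3/2 * T ^ 4 + 51/2 * T ^ 3 - 202 * T ^ 2 + 7493/10 * T) * (d * 1 * x ^ 1)
     + (3 * T ^ 3 - 153/4 * T ^ 2 + 202 * T - 7493/20) * (d * 1 * x ^ 2)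
     + (- 3 * T ^ 2 + 51/2 * T - 202/3) * (d * 1 * x ^ 3)
     + (3/2 * T - 51/8) * (d * 1 * x ^ 4) + (- 3/10) * (d * 1 * x ^ 5)
     + (- 9/4 * T ^ 2) * (d * e * x ^ 0) + (9/2 * T) * (d * e * x ^ 1) + (- 9/4) * (d * e * x ^ 2)
     + T * (d * c * x ^ 0) + (- 1) * (d * c * x ^ 1) + (- 1) * (d * z * x ^ 0)"
  by (simp add: field_simps eval_nat_numeral)

lemma L_formula_recurrence:
  assumes "20 \<le> n"
  shows "(\<Sum>j\<in>{0..<20}. den_coeffs ! j * L_formula (n - j)) = 0"
proof -
  have "(\<Sum>j\<in>{0..<20}. den_coeffs ! j * L_formula (n - j)) = (\<Sum>j\<in>{0..<20}. den_coeffs ! j *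
     (3/10 * (real n - real j) ^ 5 - 51/8 * (real n - real j) ^ 4 + 202/3 * (real n - real j) ^ 3
     - (7493/20 + 9/4 * of_bool (even (n - j))) * (real n - real j) ^ 2
     + c1 (n - j) * (real n - real j) - c0 (n - j)))"
    by (rule sum.cong[OF refl]) (use assms in \<open>simp add: L_formula_def of_nat_diff\<close>)
  also have "\<dots> = 0"
  proof -
    have m: "moment (\<lambda>_. 1) 0 = 0" "moment (\<lambda>_. 1) 1 = 0" "moment (\<lambda>_. 1) 2 = 0"
      "moment (\<lambda>_. 1) 3 = 0" "moment (\<lambda>_. 1) 4 = 0" "moment (\<lambda>_. 1) 5 = 0"
      by (rule moment_1, simp)+
    have e: "moment (\<lambda>j. of_bool (even (n - j))) 0 = 0" "moment (\<lambda>j. of_bool (even (n - j))) 1 = 0"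
      "moment (\<lambda>j. of_bool (even (n - j))) 2 = 0"
      by (rule moment_parity[OF assms], simp)+
    have c: "moment (\<lambda>j. c1 (n - j)) 0 = 0" "moment (\<lambda>j. c1 (n - j)) 1 = 0"
      by (rule moment_c1[OF assms], simp)+
    show ?thesis
      unfolding L_formula_shift_expand sum.distrib sum_distrib_left[symmetric] moment_eq_sum[symmetric]
      by (simp only: m e c moment_c0[OF assms] mult_zero_right add_0)
  qed
  finally show ?thesis .
qed

section \<open>Coefficients of the rational function\<close>

definition num_coeffs :: "real list" where
  "num_coeffs = [0, 0, 0, 0, 12, 48, 96, 264, 732, 1500, 2172, 2520, 2376, 2172, 2148, 2532, 3000, 3120, 2280, 948]"

definition gf_den :: "real fps" where
  "gf_den = (1 - fps_X ^ 2) ^ 2 * (1 - fps_X ^ 3) ^ 2 * (1 - fps_X ^ 4) * (1 - fps_X ^ 5)"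

definition gf_num :: "real fps" where
  "gf_num = 12 * fps_X ^ 4 *
             (79 * fps_X ^ 15 + 190 * fps_X ^ 14 + 260 * fps_X ^ 13 + 250 * fps_X ^ 12
              + 211 * fps_X ^ 11 + 179 * fps_X ^ 10 + 181 * fps_X ^ 9 + 198 * fps_X ^ 8
              + 210 * fps_X ^ 7 + 181 * fps_X ^ 6 + 125 * fps_X ^ 5 + 61 * fps_X ^ 4
              + 22 * fps_X ^ 3 + 8 * fps_X ^ 2 + 4 * fps_X + 1)"

lemma fps_of_poly_Poly_nth: "fps_nth (fps_of_poly (Poly xs)) n = (if n < length xs then xs ! n else 0)"
  by (simp add: nth_default_def)

lemma gf_den_eq: "gf_den = fps_of_poly (Poly den_coeffs)"
  unfolding gf_den_def den_coeffs_def
  by (simp add: fps_of_poly_pCons numeral_eq_Suc monom_Suc monom_0)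

lemma gf_num_eq: "gf_num = fps_of_poly (Poly num_coeffs)"
  unfolding gf_num_def num_coeffs_def
  by (simp add: fps_of_poly_pCons numeral_eq_Suc monom_Suc monom_0)

text \<open>The series has no constant term, so the value -948 of the formula at 0 must be
  masked.\<close>

lemma initial_coeffs:
  "\<forall>n\<in>set [0..<20]. (\<Sum>j\<leftarrow>[0..<Suc n]. den_coeffs ! j * (if n - j > 0 then L_formula (n - j) else 0)) = num_coeffs ! n"
  by code_simp

text \<open>Multiply by the denominator. Degrees below 20 are a finite check; from 20 on,
  \<open>n - j\<close> is positive for all \<open>j < 20\<close>, so the recurrence of the formula
  gives 0.\<close>

lemma generating_function:
  "(Abs_fps (\<lambda>t. if t > 0 then real (L_c t) else 0) :: real fps) = gf_num / gf_den"
proof -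
  define f :: "real fps" where "f = Abs_fps (\<lambda>t. if t > 0 then real (L_c t) else 0)"
  have f: "fps_nth f t = (if t > 0 then L_formula t else 0)" for t
    unfolding f_def by (simp add: L_c_eq_F)
  have len: "length den_coeffs = 20" "length num_coeffs = 20"
    by (simp_all add: den_coeffs_def num_coeffs_def)
  have "gf_den * f = gf_num"
  proof (rule fps_ext)
    fix n
    have prod: "fps_nth (gf_den * f) n = (\<Sum>j\<in>{0..n}. (if j < 20 then den_coeffs ! j else 0) * fps_nth f (n - j))"
      unfolding fps_mult_nth gf_den_eq fps_of_poly_Poly_nth len ..
    show "fps_nth (gf_den * f) n = fps_nth gf_num n"
    proof (cases "n < 20")
      case True
      have "fps_nth (gf_den * f) n = (\<Sum>j\<in>{0..<Suc n}. den_coeffs ! j * (if n - j > 0 then L_formula (n - j) else 0))"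
        unfolding prod f by (rule sum.cong) (use True in auto)
      also have "\<dots> = (\<Sum>j\<leftarrow>[0..<Suc n]. den_coeffs ! j * (if n - j > 0 then L_formula (n - j) else 0))"
        by (simp only: interv_sum_list_conv_sum_set_nat set_upt)
      also have "\<dots> = num_coeffs ! n" using initial_coeffs True by simp
      finally show ?thesis using True by (simp add: gf_num_eq fps_of_poly_Poly_nth len del: fps_of_poly_nth)
    next
      case False
      have "fps_nth (gf_den * f) n = (\<Sum>j\<in>{0..<20}. den_coeffs ! j * L_formula (n - j))"
        unfolding prod f by (rule sum.mono_neutral_cong_right) (use False in auto)
      also have "\<dots> = 0" using False by (intro L_formula_recurrence) simp
      finally show ?thesis using False by (simp add: gf_num_eq fps_of_poly_Poly_nth len del: fps_of_poly_nth)
    qed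
  qed
  moreover have "fps_nth gf_den 0 \<noteq> 0" unfolding gf_den_def by simp
  hence "gf_den \<noteq> 0" by auto
  ultimately show ?thesis unfolding f_def[symmetric]
    by (metis nonzero_mult_div_cancel_left)
qed

section \<open>Period and constituents\<close>

text \<open>Two constituents serving the same residue agree on an infinite arithmetic progression,
  hence as polynomials.\<close>

lemma constituents_unique:
  assumes "constituents_of N p Q" "constituents_of N p' Q'"
  shows "Q (t mod p) = Q' (t mod p')"
proof (rule ccontr)
  assume neq: "Q (t mod p) \<noteq> Q' (t mod p')"
  \<comment> \<open>\<open>Suc k\<close> keeps the arguments positive even for
    \<open>t = 0\<close>.\<close>
  let ?u = "\<lambda>k. t + p * p' * Suc k"
  have pos: "0 < p" "0 < p'" using assms by (auto simp: constituents_of_def)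
  have "poly (Q (t mod p)) (real (?u k)) = poly (Q' (t mod p')) (real (?u k))" for k
  proof -
    have "0 < ?u k" using pos by simp
    hence "poly (Q (?u k mod p)) (real (?u k)) = poly (Q' (?u k mod p')) (real (?u k))"
      using assms unfolding constituents_of_def by metis
    moreover have "?u k mod p = t mod p" "?u k mod p' = t mod p'"
      by (metis mod_mult_self2 mult.assoc, metis mod_mult_self2 mult.assoc mult.commute)
    ultimately show ?thesis by simp
  qed
  hence "range (\<lambda>k. real (?u k)) \<subseteq> {x. poly (Q (t mod p) - Q' (t mod p')) x = 0}" by auto
  moreover have "finite {x. poly (Q (t mod p) - Q' (t mod p')) x = 0}"
    using neq by (intro poly_roots_finite) simp
  moreover have "inj (\<lambda>k. real (?u k))" using pos by (auto simp: inj_def)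
  ultimately show False using finite_subset infinite_UNIV_nat finite_imageD by metis
qed

definition constituent :: "nat \<Rightarrow> real poly" where
  "constituent r = [:- c0 r, c1 r, - (if even r then 3769/10 else 7493/20), 202/3, - 51/8, 3/10:]"

lemma poly_constituent:
  "poly (constituent t) x = 3/10 * x ^ 5 - 51/8 * x ^ 4 + 202/3 * x ^ 3
     - (if even t then 3769/10 else 7493/20) * x ^ 2 + c1 t * x - c0 t"
  unfolding constituent_def by (simp add: algebra_simps eval_nat_numeral)

lemma constituents_L_c: "constituents_of (\<lambda>t. real (L_c t)) 60 constituent"
proof -
  have "c1 (t mod 60) = c1 t" "even (t mod 60) = even t" for t
    using c1_add_60[of "t div 60" "t mod 60"] by (simp_all add: dvd_mod_iff)
  thus ?thesis
    by (simp add: constituents_of_def poly_constituent c0_mod_60 L_c_eq_F L_formula_def)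
qed

text \<open>Two test points are used because the value 948 at 0 recurs, for instance at 12.\<close>

lemma c0_not_periodic: "\<forall>p\<in>set [1..<60]. c0 p \<noteq> c0 0 \<or> c0 (1 + p) \<noteq> c0 1"
  by code_simp

text \<open>By uniqueness, constituents with period \<open>p\<close> force those at \<open>t\<close>
  and \<open>t + p\<close> to coincide. Their constant terms then make \<open>p\<close> a period of
  \<open>c0\<close>.\<close>

lemma period_L_c: "quasipolynomial_period (\<lambda>t. real (L_c t)) = 60"
  unfolding quasipolynomial_period_def
proof (rule Least_equality)
  show "\<exists>Q. constituents_of (\<lambda>t. real (L_c t)) 60 Q" using constituents_L_c by blast
next
  fix p assume "\<exists>Q. constituents_of (\<lambda>t. real (L_c t)) p Q"
  then obtain Q where Q: "constituents_of (\<lambda>t. real (L_c t)) p Q" by blast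
  hence p: "0 < p" by (simp add: constituents_of_def)
  have "c0 (t + p) = c0 t" for t
  proof -
    have "constituent ((t + p) mod 60) = constituent (t mod 60)"
      using constituents_unique[OF constituents_L_c Q, of t]
        constituents_unique[OF constituents_L_c Q, of "t + p"] by simp
    thus ?thesis by (simp add: constituent_def c0_mod_60)
  qed
  from this[of 0] this[of 1] c0_not_periodic p show "60 \<le> p" by (cases "p < 60") auto
qed

lemma principal_L_c:
  "principal_constituent (\<lambda>t. real (L_c t)) = [:-948, 994, -3769/10, 202/3, -51/8, 3/10:]"
  unfolding principal_constituent_def period_L_c
proof (rule the_equality)
  have c: "constituent 0 = [:-948, 994, -3769/10, 202/3, -51/8, 3/10:]"
    by (simp add: constituent_def c0_def c0_table_def c1_def)
  show "\<exists>Q. constituents_of (\<lambda>t. real (L_c t)) 60 Q \<and> Q 0 = [:-948, 994, -3769/10, 202/3, -51/8, 3/10:]"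
    using constituents_L_c c by blast
  show "P = [:-948, 994, -3769/10, 202/3, -51/8, 3/10:]"
    if "\<exists>Q. constituents_of (\<lambda>t. real (L_c t)) 60 Q \<and> Q 0 = P" for P
    using that constituents_unique[OF _ constituents_L_c, of _ _ 0] c by auto
qed

theorem mainTheorem5:
  shows "(Abs_fps (\<lambda>t. if t > 0 then real (L_c t) else 0) :: real fps) =
           (12 * fps_X ^ 4 *
             (79 * fps_X ^ 15 + 190 * fps_X ^ 14 + 260 * fps_X ^ 13 + 250 * fps_X ^ 12
              + 211 * fps_X ^ 11 + 179 * fps_X ^ 10 + 181 * fps_X ^ 9 + 198 * fps_X ^ 8
              + 210 * fps_X ^ 7 + 181 * fps_X ^ 6 + 125 * fps_X ^ 5 + 61 * fps_X ^ 4
              + 22 * fps_X ^ 3 + 8 * fps_X ^ 2 + 4 * fps_X + 1)) /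
           ((1 - fps_X ^ 2) ^ 2 * (1 - fps_X ^ 3) ^ 2 * (1 - fps_X ^ 4) * (1 - fps_X ^ 5))
       \<and> (\<forall>t\<ge>1. real (L_c t) =
            (if even t
             then 3/10 * real t ^ 5 - 51/8 * real t ^ 4 + 202/3 * real t ^ 3
                  - 3769/10 * real t ^ 2 + c1 t * real t - c0 t
             else 3/10 * real t ^ 5 - 51/8 * real t ^ 4 + 202/3 * real t ^ 3
                  - 7493/20 * real t ^ 2 + c1 t * real t - c0 t))
       \<and> quasipolynomial (\<lambda>t. real (L_c t))
       \<and> quasipolynomial_period (\<lambda>t. real (L_c t)) = 60
       \<and> principal_constituent (\<lambda>t. real (L_c t))
           = [:-948, 994, -3769/10, 202/3, -51/8, 3/10:]"
proof (intro conjI)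
  show "\<forall>t\<ge>1. real (L_c t) =
            (if even t
             then 3/10 * real t ^ 5 - 51/8 * real t ^ 4 + 202/3 * real t ^ 3
                  - 3769/10 * real t ^ 2 + c1 t * real t - c0 t
             else 3/10 * real t ^ 5 - 51/8 * real t ^ 4 + 202/3 * real t ^ 3
                  - 7493/20 * real t ^ 2 + c1 t * real t - c0 t)"
    by (auto simp: L_c_eq_F L_formula_def)
  show "quasipolynomial (\<lambda>t. real (L_c t))"
    unfolding quasipolynomial_def using constituents_L_c by blast
qed (use generating_function period_L_c principal_L_c in \<open>simp_all only: gf_num_def gf_den_def\<close>)

end
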